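(* Let $k_\mathcal{G}=k_\mathcal{H}=1$ and $n_\mathcal{G},n_\mathcal{H}>1$. Then there is no integer $\ell<(n_\mathcal{G}+n_\mathcal{H}-1)/2$ such that $f_{\text{viz}}$ is $\ell$-SOS modulo $I_{\text{viz}}$ (i.e., there is no SOS-certificate of $f_{\text{viz}}$ of degree $\ell<(n_\mathcal{G}+n_\mathcal{H}-1)/2$).
   Context: Let $\mathbb{K}\subseteq\mathbb{R}$ be a field and $n_\mathcal{G},n_\mathcal{H}$ positive integers. Let $V(\mathcal{G})=\{g_1,\dots,g_{n_\mathcal{G}}\}$, $V(\mathcal{H})=\{h_1,\dots,h_{n_\mathcal{H}}\}$, $V(\mathcal{G}\square\mathcal{H})=V(\mathcal{G})\times V(\mathcal{H})$. Introduce an edge variable $e_{gg'}=e_{g'g}$ for every unordered pair of distinct $g,g'\in V(\mathcal{G})$, an edge variable $e_{hh'}=e_{h'h}$ for every unordered pair of distinct $h,h'\in V(\mathcal{H})$, and a vertex variable $x_{gh}$ for every $(g,h)\in V(\mathcal{G}\square\mathcal{H})$; let $P$ be the polynomial ring over $\mathbb{K}$ in all these variables. For $k_\mathcal{G}=k_\mathcal{H}=1$ (minimum dominating sets $\{g_1\}$ and $\{h_1\}$) the Vizing ideal $I_{\text{viz}}\subseteq P$ is generated by: $e_{gg'}(e_{gg'}-1)$ for all distinct $g,g'\in V(\mathcal{G})$; $1-e_{gg_1}$ for all $g\ne g_1$; $e_{hh'}(e_{hh'}-1)$ for all distinct $h,h'\in V(\mathcal{H})$; $1-e_{hh_1}$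 for all $h\neq h_1$; and, for all $(g,h)$, $x_{gh}(x_{gh}-1)$ and $(1-x_{gh})\prod_{g'\ne g}(1-e_{gg'}x_{g'h})\prod_{h'\neq h}(1-e_{hh'}x_{gh'})$. The Vizing polynomial is $f_{\text{viz}}=\big(\sum_{(g,h)\in V(\mathcal{G}\square\mathcal{H})}x_{gh}\big)-k_\mathcal{G}k_\mathcal{H}$. A polynomial $f\in P$ is $\ell$-SOS modulo an ideal $I$ if there exist $s_1,\dots,s_t\in P$ of degree at most $\ell$ with $f-\sum_{i=1}^t s_i^2\in I$; then $s_1,\dots,s_t$ form an SOS-certificate of degree $\ell$. *)

theory Defs
  imports Complex_Main "HOL-Algebra.Algebraic_Closure_Type" "HOL-Library.Poly_Mapping"
begin

section \<open>Multivariate polynomials over a subfield of the reals\<close>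

text \<open>
  A monomial is a finitely supported exponent function, a polynomial a finitely supported
  coefficient function on monomials; multiplication in \<^typ>\<open>('v \<Rightarrow>\<^sub>0 nat) \<Rightarrow>\<^sub>0 real\<close> is convolution.
\<close>

type_synonym 'v rpoly = "('v \<Rightarrow>\<^sub>0 nat) \<Rightarrow>\<^sub>0 real"

definition pvar :: "'v \<Rightarrow> 'v rpoly" where
  "pvar v = Poly_Mapping.single (Poly_Mapping.single v 1) 1"

definition indets :: "'v rpoly \<Rightarrow> 'v set" where
  "indets p = (\<Union>m\<in>Poly_Mapping.keys p. Poly_Mapping.keys m)"

definition mono_degree :: "('v \<Rightarrow>\<^sub>0 nat) \<Rightarrow> nat" where
  "mono_degree m = (\<Sum>v\<in>Poly_Mapping.keys m. Poly_Mapping.lookup m v)"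

text \<open>Total degree; the zero polynomial gets degree \<open>0\<close>.\<close>

definition total_degree :: "'v rpoly \<Rightarrow> nat" where
  "total_degree p = Max (insert 0 (mono_degree ` Poly_Mapping.keys p))"

definition mpoly_ring :: "real set \<Rightarrow> 'v set \<Rightarrow> 'v rpoly ring" where
  "mpoly_ring K V = ring_of_type_algebra
     \<lparr>carrier := {p. range (Poly_Mapping.lookup p) \<subseteq> K \<and> indets p \<subseteq> V}\<rparr>"

definition sos_modulo :: "'v rpoly ring \<Rightarrow> 'v rpoly set \<Rightarrow> int \<Rightarrow> 'v rpoly \<Rightarrow> bool" where
  "sos_modulo P I l f \<longleftrightarrow>
     (\<exists>ss. set ss \<subseteq> carrier P \<and> (\<forall>s\<in>set ss. int (total_degree s) \<le> l) \<and>
           f - (\<Sum>s\<leftarrow>ss. s\<^sup>2) \<in> I)"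


section \<open>The Vizing ideal and the Vizing polynomial\<close>

text \<open>
  The vertex sets of the two graphs are \<open>{1..nG}\<close> and \<open>{1..nH}\<close>, with \<open>g\<^sub>i\<close> and \<open>h\<^sub>i\<close> encoded
  as \<open>i\<close>. Edge variables are indexed by two-element sets of vertices.
\<close>

datatype viz_var = EdgeG "nat set" | EdgeH "nat set" | Vert nat nat

definition viz_vars :: "nat \<Rightarrow> nat \<Rightarrow> viz_var set" where
  "viz_vars nG nH =
     {EdgeG {g, g'} | g g'. g \<in> {1..nG} \<and> g' \<in> {1..nG} \<and> g \<noteq> g'} \<union>
     {EdgeH {h, h'} | h h'. h \<in> {1..nH} \<and> h' \<in> {1..nH} \<and> h \<noteq> h'} \<union>
     {Vert g h | g h. g \<in> {1..nG} \<and> h \<in> {1..nH}}"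

abbreviation eG :: "nat \<Rightarrow> nat \<Rightarrow> viz_var rpoly" where
  "eG g g' \<equiv> pvar (EdgeG {g, g'})"

abbreviation eH :: "nat \<Rightarrow> nat \<Rightarrow> viz_var rpoly" where
  "eH h h' \<equiv> pvar (EdgeH {h, h'})"

abbreviation xv :: "nat \<Rightarrow> nat \<Rightarrow> viz_var rpoly" where
  "xv g h \<equiv> pvar (Vert g h)"

abbreviation viz_ring :: "real set \<Rightarrow> nat \<Rightarrow> nat \<Rightarrow> viz_var rpoly ring" where
  "viz_ring K nG nH \<equiv> mpoly_ring K (viz_vars nG nH)"

text \<open>
  Generators for domination numbers \<open>k\<^sub>G = k\<^sub>H = 1\<close>, where vertex \<open>1\<close> of each graph is a
  minimum dominating set.
\<close>

definition viz_gens :: "nat \<Rightarrow> nat \<Rightarrow> viz_var rpoly set" where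
  "viz_gens nG nH =
     {eG g g' * (eG g g' - 1) | g g'. g \<in> {1..nG} \<and> g' \<in> {1..nG} \<and> g \<noteq> g'} \<union>
     {1 - eG g 1 | g. g \<in> {1..nG} \<and> g \<noteq> 1} \<union>
     {eH h h' * (eH h h' - 1) | h h'. h \<in> {1..nH} \<and> h' \<in> {1..nH} \<and> h \<noteq> h'} \<union>
     {1 - eH h 1 | h. h \<in> {1..nH} \<and> h \<noteq> 1} \<union>
     {xv g h * (xv g h - 1) | g h. g \<in> {1..nG} \<and> h \<in> {1..nH}} \<union>
     {(1 - xv g h) * (\<Prod>g'\<in>{1..nG} - {g}. 1 - eG g g' * xv g' h)
                   * (\<Prod>h'\<in>{1..nH} - {h}. 1 - eH h h' * xv g h')
        | g h. g \<in> {1..nG} \<and> h \<in> {1..nH}}"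

definition viz_ideal :: "real set \<Rightarrow> nat \<Rightarrow> nat \<Rightarrow> viz_var rpoly set" where
  "viz_ideal K nG nH = Idl\<^bsub>viz_ring K nG nH\<^esub> (viz_gens nG nH)"

definition viz_poly :: "nat \<Rightarrow> nat \<Rightarrow> nat \<Rightarrow> nat \<Rightarrow> viz_var rpoly" where
  "viz_poly nG nH kG kH = (\<Sum>(g, h)\<in>{1..nG} \<times> {1..nH}. xv g h) - of_nat (kG * kH)"


section \<open>Well-definedness of the ring and the ideal\<close>

text \<open>
  \<^const>\<open>genideal\<close> is the intersection of all ideals containing the given set, so it is
  meaningful only if the ambient structure is a ring and contains the generators.
\<close>

lemma subfield_real_closed:
  assumes "subfield K (ring_of_type_algebra :: real ring)"
  shows "0 \<in> K" "1 \<in> K" "a \<in> K \<Longrightarrow> b \<in> K \<Longrightarrow> a + b \<in> K"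
    "a \<in> K \<Longrightarrow> b \<in> K \<Longrightarrow> a * b \<in> K" "a \<in> K \<Longrightarrow> - a \<in> K"
proof -
  interpret R: field "ring_of_type_algebra :: real ring"
    by (rule field_from_type_algebra)
  have sub: "subring K (ring_of_type_algebra :: real ring)"
    using assms by (meson subcring.axioms(1) subdomain.axioms(1) subfield.axioms(1))
  show z: "0 \<in> K" "1 \<in> K" "a \<in> K \<Longrightarrow> b \<in> K \<Longrightarrow> a + b \<in> K" "a \<in> K \<Longrightarrow> b \<in> K \<Longrightarrow> a * b \<in> K"
    using subringE(2,3)[OF sub] subringE(7)[OF sub, of a b] subringE(6)[OF sub, of a b]
    by (simp_all add: ring_of_type_algebra_def)
  assume a: "a \<in> K"
  have "\<ominus>\<^bsub>ring_of_type_algebra\<^esub> a = - a"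
    by (rule R.minus_equality) (simp_all add: ring_of_type_algebra_def)
  then show "- a \<in> K"
    using subringE(5)[OF sub a] by simp
qed

lemma indets_plus: "indets (p + q) \<subseteq> indets p \<union> indets q"
  using Poly_Mapping.keys_add[of p q] unfolding indets_def by blast

lemma indets_times: "indets (p * q) \<subseteq> indets p \<union> indets q"
proof
  fix v assume "v \<in> indets (p * q)"
  then obtain m where m: "m \<in> Poly_Mapping.keys (p * q)" "v \<in> Poly_Mapping.keys m"
    by (auto simp: indets_def)
  then obtain a b where "m = a + b" "a \<in> Poly_Mapping.keys p" "b \<in> Poly_Mapping.keys q"
    using keys_mult[of p q] by blast
  then show "v \<in> indets p \<union> indets q"
    using m(2) Poly_Mapping.keys_add[of a b] by (auto simp: indets_def)
qed

lemma lookup_times_closed: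
  fixes p q :: "'v rpoly"
  assumes "0 \<in> K" "\<And>a b. a \<in> K \<Longrightarrow> b \<in> K \<Longrightarrow> a + b \<in> K" "\<And>a b. a \<in> K \<Longrightarrow> b \<in> K \<Longrightarrow> a * b \<in> K"
    and "\<And>m. Poly_Mapping.lookup p m \<in> K" "\<And>m. Poly_Mapping.lookup q m \<in> K"
  shows "Poly_Mapping.lookup (p * q) m \<in> K"
proof -
  have sum: "(\<Sum>a\<in>A. F a) \<in> K" if "\<And>a. F a \<in> K" for A and F :: "'b \<Rightarrow> real"
    by (induction A rule: infinite_finite_induct) (use assms that in auto)
  show ?thesis
    unfolding lookup_mult Sum_any.expand_set
    by (intro sum assms(3,4)) (auto simp: when_def assms)
qed

lemma mpoly_ring_simps:
  "p \<in> carrier (mpoly_ring K V) \<longleftrightarrow> (\<forall>m. Poly_Mapping.lookup p m \<in> K) \<and> indets p \<subseteq> V"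
  "\<zero>\<^bsub>mpoly_ring K V\<^esub> = 0" "\<one>\<^bsub>mpoly_ring K V\<^esub> = 1"
  "p \<oplus>\<^bsub>mpoly_ring K V\<^esub> q = p + q" "p \<otimes>\<^bsub>mpoly_ring K V\<^esub> q = p * q"
  by (auto simp: mpoly_ring_def ring_of_type_algebra_def)

context
  fixes K :: "real set"
  assumes K: "subfield K (ring_of_type_algebra :: real ring)"
begin

lemma mpoly_ring_closed:
  "0 \<in> carrier (mpoly_ring K V)" "1 \<in> carrier (mpoly_ring K V)"
  "p \<in> carrier (mpoly_ring K V) \<Longrightarrow> q \<in> carrier (mpoly_ring K V) \<Longrightarrow> p + q \<in> carrier (mpoly_ring K V)"
  "p \<in> carrier (mpoly_ring K V) \<Longrightarrow> q \<in> carrier (mpoly_ring K V) \<Longrightarrow> p * q \<in> carrier (mpoly_ring K V)"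
  "p \<in> carrier (mpoly_ring K V) \<Longrightarrow> - p \<in> carrier (mpoly_ring K V)"
proof -
  note c = subfield_real_closed[OF K]
  show "0 \<in> carrier (mpoly_ring K V)" "1 \<in> carrier (mpoly_ring K V)"
    "p \<in> carrier (mpoly_ring K V) \<Longrightarrow> - p \<in> carrier (mpoly_ring K V)"
    using c by (auto simp: mpoly_ring_simps indets_def lookup_one when_def)
  show "p \<in> carrier (mpoly_ring K V) \<Longrightarrow> q \<in> carrier (mpoly_ring K V) \<Longrightarrow> p + q \<in> carrier (mpoly_ring K V)"
    using c(3) indets_plus[of p q] by (auto simp: mpoly_ring_simps lookup_add)
  show "p \<in> carrier (mpoly_ring K V) \<Longrightarrow> q \<in> carrier (mpoly_ring K V) \<Longrightarrow> p * q \<in> carrier (mpoly_ring K V)"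
    using indets_times[of p q] lookup_times_closed[of K p q, OF c(1,3,4)]
    unfolding mpoly_ring_simps(1) by blast
qed

lemma cring_mpoly_ring: "cring (mpoly_ring K V)"
proof (intro cringI abelian_groupI comm_monoidI)
  fix p assume "p \<in> carrier (mpoly_ring K V)"
  then show "\<exists>q\<in>carrier (mpoly_ring K V). q \<oplus>\<^bsub>mpoly_ring K V\<^esub> p = \<zero>\<^bsub>mpoly_ring K V\<^esub>"
    using mpoly_ring_closed(5) by (intro bexI[of _ "- p"]) (auto simp: mpoly_ring_simps(2-))
qed (auto simp: mpoly_ring_simps(2-) mpoly_ring_closed algebra_simps)

lemma pvar_in_mpoly_ring: "v \<in> V \<Longrightarrow> pvar v \<in> carrier (mpoly_ring K V)"
  using subfield_real_closed(1,2)[OF K]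
  by (auto simp: mpoly_ring_simps indets_def pvar_def lookup_single when_def split: if_splits)

lemma mpoly_ring_diff:
  "p \<in> carrier (mpoly_ring K V) \<Longrightarrow> q \<in> carrier (mpoly_ring K V) \<Longrightarrow> p - q \<in> carrier (mpoly_ring K V)"
  using mpoly_ring_closed(3)[of p V "- q"] mpoly_ring_closed(5)[of q V] by simp

lemma mpoly_ring_prod:
  "(\<And>a. a \<in> A \<Longrightarrow> F a \<in> carrier (mpoly_ring K V)) \<Longrightarrow> prod F A \<in> carrier (mpoly_ring K V)"
  by (induction A rule: infinite_finite_induct) (auto intro: mpoly_ring_closed)

lemma viz_gens_subset:
  assumes "nG \<ge> 1" "nH \<ge> 1"
  shows "viz_gens nG nH \<subseteq> carrier (viz_ring K nG nH)"
proof -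
  have 1: "eG g g' \<in> carrier (viz_ring K nG nH)"
    if "g \<in> {1..nG}" "g' \<in> {1..nG}" "g \<noteq> g'" for g g'
    by (rule pvar_in_mpoly_ring) (use that in \<open>auto simp: viz_vars_def\<close>)
  have 2: "eH h h' \<in> carrier (viz_ring K nG nH)"
    if "h \<in> {1..nH}" "h' \<in> {1..nH}" "h \<noteq> h'" for h h'
    by (rule pvar_in_mpoly_ring) (use that in \<open>auto simp: viz_vars_def\<close>)
  have 3: "xv g h \<in> carrier (viz_ring K nG nH)" if "g \<in> {1..nG}" "h \<in> {1..nH}" for g h
    by (rule pvar_in_mpoly_ring) (use that in \<open>auto simp: viz_vars_def\<close>)
  have 4: "1 \<in> {1..nG}" "1 \<in> {1..nH}"
    using assms by auto
  show ?thesis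
    unfolding viz_gens_def Un_subset_iff
    by (intro conjI subsetI; elim CollectE exE conjE; hypsubst;
        intro mpoly_ring_closed mpoly_ring_diff mpoly_ring_prod 1 2 3)
       (use 4 in auto)
qed

end

end

theory Submission
  imports Defs
begin

text \<open>
  Set all edge variables to \<open>1\<close>, so that both graphs are complete. A point with vertex
  coordinates in \<open>{0, 1}\<close> is then a zero of the Vizing ideal unless it vanishes on some cross
  (the closed neighbourhood of a vertex of the product), and every cross has \<open>nG + nH - 1\<close>
  elements. Expanding in the variables \<open>1 - x\<close>, a polynomial that is nonzero at some point
  contains a monomial supported on a minimal zero set of such points; hence a polynomial of degree
  less than \<open>nG + nH - 1\<close> in the ideal vanishes at all these points, including the empty vertex
  set \<open>x = 0\<close>. But there \<open>f - \<Sum> s\<^sub>i\<^sup>2\<close> has value at most \<open>-1\<close>.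
\<close>

section \<open>Evaluation of monomials and polynomials at real points\<close>

definition mono_eval :: "('v \<Rightarrow> real) \<Rightarrow> ('v \<Rightarrow>\<^sub>0 nat) \<Rightarrow> real" where
  "mono_eval a m = (\<Prod>v\<in>Poly_Mapping.keys m. a v ^ Poly_Mapping.lookup m v)"

definition poly_eval :: "('v \<Rightarrow> real) \<Rightarrow> 'v rpoly \<Rightarrow> real" where
  "poly_eval a p = (\<Sum>m\<in>Poly_Mapping.keys p. Poly_Mapping.lookup p m * mono_eval a m)"

lemma mono_eval_superset:
  assumes "finite A" "Poly_Mapping.keys m \<subseteq> A"
  shows "mono_eval a m = (\<Prod>v\<in>A. a v ^ Poly_Mapping.lookup m v)"
  unfolding mono_eval_def using assms
  by (intro prod.mono_neutral_left) (auto simp: in_keys_iff)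

lemma mono_eval_add: "mono_eval a (m + n) = mono_eval a m * mono_eval a n"
proof -
  let ?A = "Poly_Mapping.keys m \<union> Poly_Mapping.keys n"
  show ?thesis
    using Poly_Mapping.keys_add[of m n]
    by (simp add: mono_eval_superset[of ?A] lookup_add power_add prod.distrib)
qed

lemma mono_degree_superset:
  assumes "finite A" "Poly_Mapping.keys m \<subseteq> A"
  shows "mono_degree m = (\<Sum>v\<in>A. Poly_Mapping.lookup m v)"
  unfolding mono_degree_def using assms
  by (intro sum.mono_neutral_left) (auto simp: in_keys_iff)

lemma mono_degree_add: "mono_degree (m + n) = mono_degree m + mono_degree n"
proof -
  let ?A = "Poly_Mapping.keys m \<union> Poly_Mapping.keys n"
  show ?thesis
    using Poly_Mapping.keys_add[of m n]
    by (simp add: mono_degree_superset[of ?A] lookup_add sum.distrib)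
qed

text \<open>Each variable in the support has exponent at least 1. A degree bound thus limits the
  number of variables on which a monomial depends.\<close>

lemma card_keys_le_mono_degree: "card (Poly_Mapping.keys m) \<le> mono_degree m"
proof -
  have "(\<Sum>v\<in>Poly_Mapping.keys m. 1) \<le> mono_degree m"
    unfolding mono_degree_def by (intro sum_mono) (auto simp: in_keys_iff)
  then show ?thesis by simp
qed

lemma poly_eval_superset:
  assumes "finite A" "Poly_Mapping.keys p \<subseteq> A"
  shows "poly_eval a p = (\<Sum>m\<in>A. Poly_Mapping.lookup p m * mono_eval a m)"
  unfolding poly_eval_def using assms
  by (intro sum.mono_neutral_left) (auto simp: in_keys_iff)

lemma poly_eval_add: "poly_eval a (p + q) = poly_eval a p + poly_eval a q"
proof -
  let ?A = "Poly_Mapping.keys p \<union> Poly_Mapping.keys q"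
  show ?thesis
    using Poly_Mapping.keys_add[of p q]
    by (simp add: poly_eval_superset[of ?A] lookup_add distrib_right sum.distrib)
qed

lemma poly_eval_zero [simp]: "poly_eval a 0 = 0"
  by (simp add: poly_eval_def)

lemma poly_eval_single [simp]: "poly_eval a (Poly_Mapping.single m c) = c * mono_eval a m"
  by (simp add: poly_eval_def)

lemma poly_eval_one [simp]: "poly_eval a 1 = 1"
proof -
  have "poly_eval a (Poly_Mapping.single 0 1) = 1"
    by (simp only: poly_eval_single) (simp add: mono_eval_def)
  then show ?thesis by simp
qed

lemma poly_eval_pvar [simp]: "poly_eval a (pvar v) = a v"
  by (simp add: pvar_def mono_eval_def)

lemma poly_eval_diff: "poly_eval a (p - q) = poly_eval a p - poly_eval a q"
  using poly_eval_add[of a "p - q" q] by simp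

lemma poly_eval_sum: "poly_eval a (sum F A) = (\<Sum>i\<in>A. poly_eval a (F i))"
  by (induction A rule: infinite_finite_induct) (auto simp: poly_eval_add)

lemma poly_as_sum_monomials:
  fixes p :: "'v rpoly"
  shows "p = (\<Sum>m\<in>Poly_Mapping.keys p. Poly_Mapping.single m (Poly_Mapping.lookup p m))"
  by (rule poly_mapping_eqI) (auto simp: lookup_sum lookup_single when_def in_keys_iff)

text \<open>Expanding both factors reduces the claim to single terms, where
  \<open>mono_eval_add\<close> applies.\<close>

lemma poly_eval_mult: "poly_eval a (p * q) = poly_eval a p * poly_eval a q"
proof -
  have "p * q = (\<Sum>m\<in>Poly_Mapping.keys p. \<Sum>n\<in>Poly_Mapping.keys q.
      Poly_Mapping.single (m + n) (Poly_Mapping.lookup p m * Poly_Mapping.lookup q n))"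
    by (subst (1) poly_as_sum_monomials[of p], subst (1) poly_as_sum_monomials[of q])
       (simp add: sum_product mult_single)
  then show ?thesis
    by (simp add: poly_eval_sum mono_eval_add)
       (simp add: poly_eval_def sum_product mult_ac)
qed

lemma poly_eval_prod: "poly_eval a (prod F A) = (\<Prod>i\<in>A. poly_eval a (F i))"
  by (induction A rule: infinite_finite_induct) (auto simp: poly_eval_mult)

lemma poly_eval_sum_list_squares:
  "poly_eval a (\<Sum>s\<leftarrow>ss. s\<^sup>2) = (\<Sum>s\<leftarrow>ss. (poly_eval a s)\<^sup>2)"
  by (induction ss) (auto simp: poly_eval_add poly_eval_mult power2_eq_square)

section \<open>Total degree: upper bounds and vanishing alternating sums\<close>

lemma mono_degree_le_total_degree:
  "m \<in> Poly_Mapping.keys p \<Longrightarrow> mono_degree m \<le> total_degree p"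
  by (simp add: total_degree_def)

lemma total_degree_le_iff:
  "total_degree p \<le> d \<longleftrightarrow> (\<forall>m\<in>Poly_Mapping.keys p. mono_degree m \<le> d)"
  by (auto simp: total_degree_def)

lemma total_degree_add_le:
  "total_degree p \<le> d \<Longrightarrow> total_degree q \<le> d \<Longrightarrow> total_degree (p + q) \<le> d"
  using Poly_Mapping.keys_add[of p q] by (auto simp: total_degree_le_iff)

lemma total_degree_diff_le:
  "total_degree p \<le> d \<Longrightarrow> total_degree q \<le> d \<Longrightarrow> total_degree (p - q) \<le> d"
  \<comment> \<open>Negation keeps the support and hence the degree.\<close>
  using total_degree_add_le[of p d "- q"] by (simp add: total_degree_def)

lemma total_degree_mult_le: "total_degree (p * q) \<le> total_degree p + total_degree q"
  unfolding total_degree_le_iff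
proof
  fix m assume "m \<in> Poly_Mapping.keys (p * q)"
  then obtain k n where "m = k + n" "k \<in> Poly_Mapping.keys p" "n \<in> Poly_Mapping.keys q"
    using keys_mult[of p q] by blast
  then show "mono_degree m \<le> total_degree p + total_degree q"
    by (simp add: mono_degree_add add_mono mono_degree_le_total_degree)
qed

lemma total_degree_0 [simp]: "total_degree 0 = 0"
  by (simp add: total_degree_def)

lemma total_degree_1 [simp]: "total_degree 1 = 0"
  by (simp add: total_degree_def mono_degree_def)

lemma total_degree_sum_le:
  "(\<And>i. i \<in> A \<Longrightarrow> total_degree (F i) \<le> d) \<Longrightarrow> total_degree (sum F A) \<le> d"
  by (induction A rule: infinite_finite_induct)
     (auto intro: total_degree_add_le)

lemma total_degree_sum_list_squares_le:
  assumes "\<And>s. s \<in> set ss \<Longrightarrow> 2 * total_degree s \<le> d"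
  shows "total_degree (\<Sum>s\<leftarrow>ss. s\<^sup>2) \<le> d"
  using assms
proof (induction ss)
  case (Cons s ss)
  have "total_degree (s\<^sup>2) \<le> d"
    using total_degree_mult_le[of s s] Cons.prems[of s] by (simp add: power2_eq_square)
  with Cons show ?case by (auto intro: total_degree_add_le)
qed simp

lemma total_degree_viz_poly_le: "total_degree (viz_poly nG nH kG kH) \<le> 1"
proof -
  have "total_degree (xv g h) \<le> 1" for g h
    by (simp add: total_degree_le_iff pvar_def mono_degree_def)
  moreover have "total_degree (of_nat n :: viz_var rpoly) \<le> 1" for n
    by (induction n) (auto intro: total_degree_add_le)
  ultimately show ?thesis
    unfolding viz_poly_def
    by (intro total_degree_diff_le total_degree_sum_le) (auto split: prod.splits simp del: of_nat_mult)
qed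

text \<open>A mixed difference in \<open>card S\<close> distinct variables kills every polynomial of
  smaller degree. By linearity a monomial suffices; it misses some \<open>w\<close> in
  \<open>S\<close>, and toggling \<open>w\<close> in \<open>T\<close> flips the sign but not the
  value, so the subsets cancel in pairs.\<close>

lemma poly_eval_alternating_sum:
  assumes S: "finite S" and deg: "total_degree p < card S"
  shows "(\<Sum>T\<in>Pow S. (-1) ^ card T * poly_eval (\<lambda>v. if v \<in> T then b v else a v) p) = 0"
proof -
  let ?pt = "\<lambda>T v. if v \<in> T then b v else a v"
  have mono: "(\<Sum>T\<in>Pow S. (-1) ^ card T * mono_eval (?pt T) m) = 0"
    if m: "m \<in> Poly_Mapping.keys p" for m
  proof -
    have "card (Poly_Mapping.keys m) < card S"
      using card_keys_le_mono_degree[of m] mono_degree_le_total_degree[OF m] deg by linarith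
    then obtain w where w: "w \<in> S" "w \<notin> Poly_Mapping.keys m"
      by (meson card_mono finite_keys not_le subsetI)
    let ?R = "S - {w}"
    let ?F = "\<lambda>T. (-1) ^ card T * mono_eval (?pt T) m"
    have flip: "?F (insert w T) = - ?F T" if "T \<in> Pow ?R" for T
    proof -
      have "finite T" "w \<notin> T" using that S finite_subset by auto
      moreover have "mono_eval (?pt (insert w T)) m = mono_eval (?pt T) m"
        unfolding mono_eval_def using w by (intro prod.cong) auto
      ultimately show ?thesis by simp
    qed
    have "sum ?F (Pow S) = sum ?F (Pow ?R \<union> insert w ` Pow ?R)"
      using Pow_insert[of w ?R] w(1) by (simp add: insert_absorb)
    also have "\<dots> = sum ?F (Pow ?R) + sum ?F (insert w ` Pow ?R)"
      using S by (intro sum.union_disjoint) auto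
    also have "sum ?F (insert w ` Pow ?R) = (\<Sum>T\<in>Pow ?R. ?F (insert w T))"
      by (rule sum.reindex_cong[OF _ refl refl]) (force simp: inj_on_def)
    also have "\<dots> = - sum ?F (Pow ?R)"
      unfolding sum_negf[symmetric] by (rule sum.cong[OF refl flip])
    finally show ?thesis by simp
  qed
  have "(\<Sum>T\<in>Pow S. (-1) ^ card T * poly_eval (?pt T) p) =
      (\<Sum>m\<in>Poly_Mapping.keys p. Poly_Mapping.lookup p m *
         (\<Sum>T\<in>Pow S. (-1) ^ card T * mono_eval (?pt T) m))"
    unfolding poly_eval_def sum_distrib_left
    by (subst sum.swap) (simp add: mult_ac)
  then show ?thesis by (simp add: mono)
qed

section \<open>Points at which members of the Vizing ideal vanish\<close>

lemma ideal_eval_zero: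
  assumes K: "subfield K (ring_of_type_algebra :: real ring)"
  shows "ideal {p \<in> carrier (mpoly_ring K V). poly_eval a p = 0} (mpoly_ring K V)"
proof -
  interpret cring "mpoly_ring K V" by (rule cring_mpoly_ring[OF K])
  \<comment> \<open>The ring's own additive inverse is identified with \<open>-\<close> by
    uniqueness of inverses.\<close>
  have uminus: "\<ominus>\<^bsub>mpoly_ring K V\<^esub> p = - p" if "p \<in> carrier (mpoly_ring K V)" for p
    using that mpoly_ring_closed(5)[OF K that]
    by (intro minus_equality) (auto simp: mpoly_ring_simps(2-))
  have neg: "poly_eval a (- p) = - poly_eval a p" for p
    using poly_eval_diff[of a 0 p] by simp
  show ?thesis
  proof (intro idealI ring_axioms)
    show "subgroup {p \<in> carrier (mpoly_ring K V). poly_eval a p = 0} (add_monoid (mpoly_ring K V))"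
      by (intro add.subgroupI)
         (auto simp: mpoly_ring_simps(2-) poly_eval_add uminus neg a_inv_def[symmetric]
               intro!: mpoly_ring_closed[OF K] exI[of _ 0])
  qed (auto simp: mpoly_ring_simps(2-) poly_eval_mult intro: mpoly_ring_closed[OF K])
qed

definition cross :: "nat \<Rightarrow> nat \<Rightarrow> nat \<Rightarrow> nat \<Rightarrow> viz_var set" where
  "cross nG nH g h = (\<lambda>g'. Vert g' h) ` {1..nG} \<union> (\<lambda>h'. Vert g h') ` {1..nH}"

text \<open>The two lines of the cross share only \<open>Vert g h\<close>, which accounts for the
  \<open>- 1\<close>.\<close>

lemma card_cross:
  assumes "g \<in> {1..nG}" "h \<in> {1..nH}"
  shows "card (cross nG nH g h) = nG + nH - 1"
proof -
  let ?A = "(\<lambda>g'. Vert g' h) ` {1..nG}" and ?B = "(\<lambda>h'. Vert g h') ` {1..nH}"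
  have "?A \<inter> ?B = {Vert g h}" using assms by auto
  moreover have "card ?A = nG" "card ?B = nH"
    by (subst card_image; simp add: inj_on_def)+
  ultimately show ?thesis
    using card_Un_Int[of ?A ?B] by (simp add: cross_def)
qed

text \<open>The set \<open>T\<close> of zero coordinates is the complement of the chosen vertex set.\<close>

abbreviation zeros_at :: "viz_var set \<Rightarrow> viz_var \<Rightarrow> real" where
  "zeros_at T \<equiv> \<lambda>v. if v \<in> T then 0 else 1"

text \<open>\<open>T\<close> holds only vertex variables, so all edge variables are 1, and every
  vertex variable is 0 or 1. Only the domination generators need the hypothesis on crosses.\<close>

lemma viz_gens_eval_zero:
  assumes T: "T \<subseteq> {Vert g h | g h. g \<in> {1..nG} \<and> h \<in> {1..nH}}"
    and free: "\<And>g h. g \<in> {1..nG} \<Longrightarrow> h \<in> {1..nH} \<Longrightarrow> \<not> cross nG nH g h \<subseteq> T"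
    and p: "p \<in> viz_gens nG nH"
  shows "poly_eval (zeros_at T) p = 0"
proof -
  have edge: "EdgeG e \<notin> T" "EdgeH e \<notin> T" for e using T by auto
  have dom: "poly_eval (zeros_at T) ((1 - xv g h) * (\<Prod>g'\<in>{1..nG} - {g}. 1 - eG g g' * xv g' h)
      * (\<Prod>h'\<in>{1..nH} - {h}. 1 - eH h h' * xv g h')) = 0"
    if gh: "g \<in> {1..nG}" "h \<in> {1..nH}" for g h
  proof -
    obtain v where "v \<in> cross nG nH g h" "v \<notin> T" using free[OF gh] by blast
    \<comment> \<open>A variable of value 1 at the centre or on either arm of the cross annihilates
      the corresponding one of the three factors.\<close>
    then have "Vert g h \<notin> T \<or> (\<exists>g'\<in>{1..nG} - {g}. Vert g' h \<notin> T) \<or>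
        (\<exists>h'\<in>{1..nH} - {h}. Vert g h' \<notin> T)"
      by (auto simp: cross_def)
    then show ?thesis
      by (auto simp: poly_eval_mult poly_eval_prod poly_eval_diff edge)
  qed
  show ?thesis
    using p unfolding viz_gens_def Un_iff
    by (elim disjE CollectE exE conjE; hypsubst)
       (use dom in \<open>auto simp: poly_eval_mult poly_eval_diff edge\<close>)
qed

text \<open>The polynomials vanishing at a point form an ideal; as it contains the generators, it
  contains the ideal they generate.\<close>

lemma viz_ideal_eval_zero:
  assumes K: "subfield K (ring_of_type_algebra :: real ring)"
    and n: "nG \<ge> 1" "nH \<ge> 1"
    and T: "T \<subseteq> {Vert g h | g h. g \<in> {1..nG} \<and> h \<in> {1..nH}}"
    and free: "\<And>g h. g \<in> {1..nG} \<Longrightarrow> h \<in> {1..nH} \<Longrightarrow> \<not> cross nG nH g h \<subseteq> T"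
    and p: "p \<in> viz_ideal K nG nH"
  shows "poly_eval (zeros_at T) p = 0"
proof -
  interpret cring "viz_ring K nG nH" by (rule cring_mpoly_ring[OF K])
  have "viz_ideal K nG nH \<subseteq> {p \<in> carrier (viz_ring K nG nH). poly_eval (zeros_at T) p = 0}"
    unfolding viz_ideal_def
    using viz_gens_subset[OF K n] viz_gens_eval_zero[OF T free]
    by (intro genideal_minimal ideal_eval_zero[OF K]) auto
  with p show ?thesis by auto
qed

text \<open>Induction on \<open>T\<close> along strict inclusion. If \<open>T\<close> contains no
  cross, the point is a zero of the ideal. Otherwise \<open>card T\<close> exceeds the degree, so
  the alternating sum over subsets of \<open>T\<close> is 0; proper subsets contribute 0 by
  induction, which leaves only the term of \<open>T\<close>.\<close>

lemma viz_ideal_low_degree_eval_zero: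
  assumes K: "subfield K (ring_of_type_algebra :: real ring)"
    and n: "nG \<ge> 1" "nH \<ge> 1"
    and p: "p \<in> viz_ideal K nG nH"
    and deg: "total_degree p < nG + nH - 1"
    and T: "T \<subseteq> {Vert g h | g h. g \<in> {1..nG} \<and> h \<in> {1..nH}}"
  shows "poly_eval (zeros_at T) p = 0"
proof -
  have "{Vert g h | g h. g \<in> {1..nG} \<and> h \<in> {1..nH}} = case_prod Vert ` ({1..nG} \<times> {1..nH})"
    by auto
  then have "finite T" using T finite_subset by fastforce
  then show ?thesis using T
  proof (induction T rule: finite_psubset_induct)
    case (psubset T)
    show ?case
    proof (cases "\<exists>g\<in>{1..nG}. \<exists>h\<in>{1..nH}. cross nG nH g h \<subseteq> T")
      case True
      then have "nG + nH - 1 \<le> card T"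
        using card_cross card_mono[OF psubset.hyps] by metis
      then have "(\<Sum>U\<in>Pow T. (-1) ^ card U * poly_eval (zeros_at U) p) = 0"
        \<comment> \<open>With \<open>b\<close> constantly 0 and \<open>a\<close> constantly 1 the
          mixed points are exactly \<open>zeros_at U\<close>.\<close>
        using poly_eval_alternating_sum[OF psubset.hyps, of p "\<lambda>_. 0" "\<lambda>_. 1"] deg by simp
      also have "(\<Sum>U\<in>Pow T. (-1) ^ card U * poly_eval (zeros_at U) p) =
          (-1) ^ card T * poly_eval (zeros_at T) p"
      proof -
        have "poly_eval (zeros_at U) p = 0" if "U \<in> Pow T - {T}" for U
          using that psubset.prems by (intro psubset.IH) auto
        then show ?thesis
          using psubset.hyps by (subst sum.remove[of _ T]) simp_all
      qed
      finally show ?thesis by simp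
    next
      case False
      then show ?thesis
        using viz_ideal_eval_zero[OF K n psubset.prems _ p] by blast
    qed
  qed
qed

theorem theorem3p13:
  fixes K :: "real set" and nG nH :: nat
  assumes "subfield K (ring_of_type_algebra :: real ring)"
    and "nG > 1" and "nH > 1"
  shows "\<not> (\<exists>l :: int. real_of_int l < (real nG + real nH - 1) / 2 \<and>
           sos_modulo (viz_ring K nG nH) (viz_ideal K nG nH) l (viz_poly nG nH 1 1))"
proof
  assume "\<exists>l :: int. real_of_int l < (real nG + real nH - 1) / 2 \<and>
    sos_modulo (viz_ring K nG nH) (viz_ideal K nG nH) l (viz_poly nG nH 1 1)"
  then obtain l :: int and ss where l: "real_of_int l < (real nG + real nH - 1) / 2"
    and ss: "\<forall>s\<in>set ss. int (total_degree s) \<le> l"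
    and mem: "viz_poly nG nH 1 1 - (\<Sum>s\<leftarrow>ss. s\<^sup>2) \<in> viz_ideal K nG nH" (is "?p \<in> _")
    unfolding sos_modulo_def by blast
  \<comment> \<open>The largest integer below \<open>nG + nH - 1\<close>, hence a bound for
    \<open>2 * l\<close>. Since \<open>nG\<close> and \<open>nH\<close> exceed 1, it is at least 2
    and also covers the linear \<open>viz_poly\<close>.\<close>
  let ?d = "nG + nH - 2"
  \<comment> \<open>All vertex variables: the point \<open>zeros_at ?T\<close> encodes the empty
    vertex set. It is reached only through the low-degree argument, since \<open>?T\<close> contains
    every cross.\<close>
  let ?T = "{Vert g h | g h. g \<in> {1..nG} \<and> h \<in> {1..nH}}"
  have "2 * l < int nG + int nH - 1" 
  proof -
    have "real_of_int (2 * l) < real_of_int (int nG + int nH - 1)" using l by simp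
    then show ?thesis by (simp only: of_int_less_iff)
  qed
  then have "2 * total_degree s \<le> ?d" if "s \<in> set ss" for s using ss that by fastforce
  moreover have "total_degree (viz_poly nG nH 1 1) \<le> ?d"
    using total_degree_viz_poly_le[of nG nH 1 1] assms(2,3) by linarith
  ultimately have "total_degree ?p \<le> ?d"
    by (intro total_degree_diff_le total_degree_sum_list_squares_le)
  then have "poly_eval (zeros_at ?T) ?p = 0"
    using assms by (intro viz_ideal_low_degree_eval_zero[OF assms(1) _ _ mem]) auto
  \<comment> \<open>Only the constant term survives. Subtracting squares keeps the value at most -1,
    which contradicts the value 0.\<close>
  moreover have "poly_eval (zeros_at ?T) (viz_poly nG nH 1 1) = -1"
    by (auto simp: viz_poly_def poly_eval_diff poly_eval_sum intro!: sum.neutral)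
  moreover have "(\<Sum>s\<leftarrow>ss. (poly_eval (zeros_at ?T) s)\<^sup>2) \<ge> 0"
    by (intro sum_list_nonneg) auto
  ultimately show False
    by (simp add: poly_eval_diff poly_eval_sum_list_squares)
qed

end
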